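(* For every positive integers $d$ and $n$, the $d$-dimensional $n$-grid has twin-width at most $3d$.
   Context: The $d$-dimensional $n$-grid $P_n^d$ is the graph with vertex set $[n]^d$ in which $(x_1,\ldots,x_d)$ and $(y_1,\ldots,y_d)$ are adjacent iff $\sum_{i=1}^d|x_i-y_i|=1$. Twin-width: a trigraph is $(V,E,R)$ with disjoint black edge set $E$ and red edge set $R$ (unordered pairs of distinct vertices); a graph $(V,E)$ is the trigraph $(V,E,\emptyset)$. Contracting distinct vertices $u,v$ replaces them by $w$, keeps the rest unchanged, and for every other $x$: $wx$ is black iff $ux,vx$ are both black; $wx$ is absent iff neither $ux$ nor $vx$ is black or red; $wx$ is red otherwise. The twin-width of an $n$-vertex graph $G$ is the least $d$ such that there is a sequence $G=G_n,\ldots,G_1$ of single contractions ending in one vertex with every $G_i$ of maximum red degree at most $d$. *)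

theory Defs
  imports Complex_Main "HOL-Library.FuncSet"
begin

text \<open>Unordered pairs of distinct vertices are two-element sets. A finite simple graph is a pair
  of a vertex set and an edge set.\<close>

type_synonym 'v graph = "'v set \<times> 'v set set"

record 'v trigraph =
  verts :: "'v set"
  black :: "'v set set"
  red :: "'v set set"

definition unordered_pairs :: "'v set \<Rightarrow> 'v set set" where
  "unordered_pairs V = {{x, y} |x y. x \<in> V \<and> y \<in> V \<and> x \<noteq> y}"

definition finite_graph :: "'v graph \<Rightarrow> bool" where
  "finite_graph G \<longleftrightarrow> finite (fst G) \<and> snd G \<subseteq> unordered_pairs (fst G)"

definition finite_trigraph :: "'v trigraph \<Rightarrow> bool" where
  "finite_trigraph T \<longleftrightarrow> finite (verts T) \<and>
     black T \<subseteq> unordered_pairs (verts T) \<and> red T \<subseteq> unordered_pairs (verts T) \<and>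
     black T \<inter> red T = {}"

definition trigraph_of :: "'v graph \<Rightarrow> 'v trigraph" where
  "trigraph_of G = \<lparr>verts = fst G, black = snd G, red = {}\<rparr>"

definition contract :: "'v trigraph \<Rightarrow> 'v \<Rightarrow> 'v \<Rightarrow> 'v \<Rightarrow> 'v trigraph" where
  "contract T u v w = (let X = verts T - {u, v} in
     \<lparr>verts = insert w X,
      black = {e \<in> black T. u \<notin> e \<and> v \<notin> e} \<union>
        {{w, x} |x. x \<in> X \<and> {u, x} \<in> black T \<and> {v, x} \<in> black T},
      red = {e \<in> red T. u \<notin> e \<and> v \<notin> e} \<union>
        {{w, x} |x. x \<in> X \<and> \<not> ({u, x} \<in> black T \<and> {v, x} \<in> black T) \<and>
           \<not> ({u, x} \<notin> black T \<union> red T \<and> {v, x} \<notin> black T \<union> red T)}\<rparr>)"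

text \<open>The name \<open>w\<close> of the new vertex is arbitrary as long as it does not clash with a remaining
  vertex; it may be \<open>u\<close> or \<open>v\<close>, so that contractions exist whatever the vertex type is.\<close>

definition contracts_to :: "'v trigraph \<Rightarrow> 'v trigraph \<Rightarrow> bool" where
  "contracts_to T T' \<longleftrightarrow> (\<exists>u v w. u \<in> verts T \<and> v \<in> verts T \<and> u \<noteq> v \<and>
     w \<notin> verts T - {u, v} \<and> T' = contract T u v w)"

definition red_degree :: "'v trigraph \<Rightarrow> 'v \<Rightarrow> nat" where
  "red_degree T x = card {y \<in> verts T. {x, y} \<in> red T}"

definition max_red_degree :: "'v trigraph \<Rightarrow> nat" where
  "max_red_degree T = Max (red_degree T ` verts T)"

text \<open>Only the values \<open>H n, \<dots>, H 1\<close> with \<open>n = card (fst G)\<close> matter.\<close>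

definition contraction_sequence :: "'v graph \<Rightarrow> (nat \<Rightarrow> 'v trigraph) \<Rightarrow> bool" where
  "contraction_sequence G H \<longleftrightarrow>
     H (card (fst G)) = trigraph_of G \<and>
     (\<forall>i\<in>{1..<card (fst G)}. contracts_to (H (Suc i)) (H i)) \<and>
     card (verts (H 1)) = 1"

definition twin_width :: "'v graph \<Rightarrow> nat" where
  "twin_width G = (LEAST k. \<exists>H. contraction_sequence G H \<and>
     (\<forall>i\<in>{1..card (fst G)}. max_red_degree (H i) \<le> k))"

definition grid_adj :: "nat \<Rightarrow> (nat \<Rightarrow> nat) \<Rightarrow> (nat \<Rightarrow> nat) \<Rightarrow> bool" where
  "grid_adj d x y \<longleftrightarrow> (\<Sum>i=1..d. \<bar>int (x i) - int (y i)\<bar>) = 1"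

definition grid :: "nat \<Rightarrow> nat \<Rightarrow> (nat \<Rightarrow> nat) graph" where
  "grid d n = (let V = {1..d} \<rightarrow>\<^sub>E {1..n} in
     (V, {{x, y} |x y. x \<in> V \<and> y \<in> V \<and> grid_adj d x y}))"

lemma finite_trigraph_trigraph_of: "finite_graph G \<Longrightarrow> finite_trigraph (trigraph_of G)"
  by (simp add: finite_graph_def finite_trigraph_def trigraph_of_def)

lemma finite_graph_grid: "finite_graph (grid d n)"
proof -
  have "x \<noteq> y" if "grid_adj d x y" for x y
    using that by (auto simp: grid_adj_def)
  then have "{{x, y} |x y. x \<in> V \<and> y \<in> V \<and> grid_adj d x y} \<subseteq> unordered_pairs V" for V
    unfolding unordered_pairs_def by blast
  then show ?thesis
    by (simp add: finite_graph_def grid_def Let_def finite_PiE)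
qed

lemma card_grid: "card (fst (grid d n)) = n ^ d"
  by (simp add: grid_def Let_def card_PiE)

lemma finite_trigraph_contract:
  assumes T: "finite_trigraph T" and w: "w \<notin> verts T - {u, v}"
  shows "finite_trigraph (contract T u v w)"
proof -
  have sub: "e \<subseteq> verts T" if "e \<in> black T \<union> red T" for e
    using T that by (auto simp: finite_trigraph_def unordered_pairs_def)
  have nw: "w \<notin> e" if "e \<in> black T \<union> red T" "u \<notin> e" "v \<notin> e" for e
    using sub[OF that(1)] that w by auto
  have old: "e \<in> unordered_pairs (insert w (verts T - {u, v}))"
    if "e \<in> black T \<union> red T" "u \<notin> e" "v \<notin> e" for e
  proof -
    from T that(1) obtain x y where "e = {x, y}" "x \<in> verts T" "y \<in> verts T" "x \<noteq> y"
      by (auto simp: finite_trigraph_def unordered_pairs_def)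
    with that(2,3) show ?thesis by (auto simp: unordered_pairs_def)
  qed
  have new: "{w, x} \<in> unordered_pairs (insert w (verts T - {u, v}))"
    if "x \<in> verts T" "x \<noteq> u" "x \<noteq> v" for x
    using that w by (auto simp: unordered_pairs_def)
  have fin: "finite (verts T)" and dis: "black T \<inter> red T = {}"
    using T by (auto simp: finite_trigraph_def)
  have "black (contract T u v w) \<inter> red (contract T u v w) = {}"
  proof -
    have "False" if b: "e \<in> black (contract T u v w)" and r: "e \<in> red (contract T u v w)" for e
    proof (cases "w \<in> e")
      case True
      from b nw True obtain x where x: "e = {w, x}" "x \<in> verts T - {u, v}"
        "{u, x} \<in> black T" "{v, x} \<in> black T"
        by (auto simp: contract_def Let_def)
      from r nw True obtain y where y: "e = {w, y}" "y \<in> verts T - {u, v}"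
        "\<not> ({u, y} \<in> black T \<and> {v, y} \<in> black T)"
        by (auto simp: contract_def Let_def)
      from x y w have "x = y" by (metis doubleton_eq_iff)
      with x y show False by blast
    next
      case False
      with b r have "e \<in> black T" "e \<in> red T" by (auto simp: contract_def Let_def)
      with dis show False by blast
    qed
    then show ?thesis by blast
  qed
  moreover have "black (contract T u v w) \<subseteq> unordered_pairs (insert w (verts T - {u, v}))"
    unfolding contract_def Let_def using old new by fastforce
  moreover have "red (contract T u v w) \<subseteq> unordered_pairs (insert w (verts T - {u, v}))"
    unfolding contract_def Let_def using old new by fastforce
  moreover have "verts (contract T u v w) = insert w (verts T - {u, v})"
    by (simp add: contract_def Let_def)
  ultimately show ?thesis
    using fin by (simp add: finite_trigraph_def)
qed

lemma contracts_to_card: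
  assumes "contracts_to T T'" and "finite_trigraph T"
  shows "finite_trigraph T'" and "Suc (card (verts T')) = card (verts T)"
proof -
  obtain u v w where uv: "u \<in> verts T" "v \<in> verts T" "u \<noteq> v" "w \<notin> verts T - {u, v}"
    and T': "T' = contract T u v w"
    using assms(1) unfolding contracts_to_def by blast
  show "finite_trigraph T'"
    unfolding T' using assms(2) uv(4) by (rule finite_trigraph_contract)
  have fin: "finite (verts T)" using assms(2) by (simp add: finite_trigraph_def)
  have "card (verts T') = Suc (card (verts T - {u, v}))"
    using uv(4) fin by (simp add: T' contract_def Let_def del: Diff_iff)
  moreover have "card {u, v} \<le> card (verts T)"
    using uv fin by (intro card_mono) auto
  moreover have "card (verts T - {u, v}) = card (verts T) - card {u, v}"
    using uv fin by (intro card_Diff_subset) auto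
  ultimately show "Suc (card (verts T')) = card (verts T)"
    using uv(3) by simp
qed

text \<open>Every nonempty finite graph has a contraction sequence, so the minimum in the definition of
  \<open>twin_width\<close> is attained.\<close>

lemma contraction_sequence_exists:
  fixes G :: "'v graph"
  assumes G: "finite_graph G" and ne: "fst G \<noteq> {}"
  shows "\<exists>H. contraction_sequence G H"
proof -
  have ex: "\<exists>T'. contracts_to T T'" if "finite_trigraph T" "card (verts T) \<ge> 2" for T :: "'v trigraph"
  proof -
    from that(2) obtain u v where "u \<in> verts T" "v \<in> verts T" "u \<noteq> v"
      by (metis card_2_iff obtain_subset_with_card_n insert_subset)
    then have "contracts_to T (contract T u v u)" unfolding contracts_to_def by blast
    then show ?thesis by (rule exI)
  qed
  define N where "N = card (fst G)"
  have N: "N \<ge> 1"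
    using G ne by (simp add: N_def finite_graph_def Suc_le_eq card_gt_0_iff)
  define f where "f = (\<lambda>T::'v trigraph. SOME T'. contracts_to T T')"
  have f: "contracts_to T (f T)" if "finite_trigraph T" "card (verts T) \<ge> 2" for T
    unfolding f_def using ex[OF that] by (rule someI_ex)
  define K where "K = (\<lambda>k. (f ^^ k) (trigraph_of G))"
  have K: "finite_trigraph (K k) \<and> card (verts (K k)) = N - k" if "k < N" for k
    using that
  proof (induction k)
    case 0
    then show ?case
      using finite_trigraph_trigraph_of[OF G] by (simp add: K_def N_def trigraph_of_def)
  next
    case (Suc k)
    then have IH: "finite_trigraph (K k)" "card (verts (K k)) = N - k" by auto
    with Suc.prems have "contracts_to (K k) (f (K k))"
      using f[of "K k"] by simp
    from contracts_to_card[OF this IH(1)] IH(2) show ?case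
      by (simp add: K_def)
  qed
  have step: "contracts_to (K k) (K (Suc k))" if "Suc k < N" for k
  proof -
    have "contracts_to (K k) (f (K k))"
      using f[of "K k"] K[of k] that by simp
    then show ?thesis by (simp add: K_def)
  qed
  have "contraction_sequence G (\<lambda>i. K (N - i))"
    unfolding contraction_sequence_def N_def[symmetric]
  proof (intro conjI ballI)
    fix i assume "i \<in> {1..<N}"
    then show "contracts_to (K (N - Suc i)) (K (N - i))"
      using step[of "N - Suc i"] by (simp add: Suc_diff_Suc)
  qed (use K[of "N - 1"] N in \<open>auto simp: K_def\<close>)
  then show ?thesis by blast
qed

end

theory Submission
  imports Defs
begin

text \<open>Order the vertices colexicographically and eliminate them from the last one down: \<open>u\<close> is
  merged into \<open>u - e\<^sub>k\<close>, where \<open>k\<close> is the last coordinate with \<open>u\<^sub>k > 1\<close>. This flattens the grid one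
  layer at a time, in the last direction still present. At every moment a remaining vertex \<open>x\<close> is
  adjacent to at most the \<open>2d\<close> vertices \<open>x \<plusminus> e\<^sub>j\<close> and to diagonal neighbours \<open>x + e\<^sub>k - e\<^sub>j\<close> or
  \<open>x - e\<^sub>k + e\<^sub>j\<close> with \<open>j < k\<close>. These arise only from the layer being merged, so only one of the two
  kinds occurs, with a single \<open>k\<close>; this leaves at most \<open>d\<close> of them.\<close>

subsection \<open>Elimination orders and twin-width\<close>

text \<open>\<open>A i\<close> bounds the union of the black and red adjacency of the trigraph on the \<open>i\<close> vertices of
  rank below \<open>i\<close>.\<close>

lemma twin_width_le_elimination:
  fixes r :: "'v \<Rightarrow> nat" and p :: "'v \<Rightarrow> 'v" and A :: "nat \<Rightarrow> 'v \<Rightarrow> 'v \<Rightarrow> bool"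
  assumes bij: "bij_betw r V {..<N}" and N: "N \<ge> 1"
    and edges: "\<And>x y. {x, y} \<in> E \<Longrightarrow> A N x y"
    and parent: "\<And>u. u \<in> V \<Longrightarrow> r u > 0 \<Longrightarrow> p u \<in> V \<and> r (p u) < r u"
    and keep: "\<And>i x y. x \<in> V \<Longrightarrow> y \<in> V \<Longrightarrow> r x < i \<Longrightarrow> r y < i \<Longrightarrow> A (Suc i) x y \<Longrightarrow> A i x y"
    and redirect: "\<And>u x. u \<in> V \<Longrightarrow> x \<in> V \<Longrightarrow> r x < r u \<Longrightarrow> x \<noteq> p u \<Longrightarrow> A (Suc (r u)) u x \<Longrightarrow>
      A (r u) (p u) x \<and> A (r u) x (p u)"
    and degree: "\<And>i x. x \<in> V \<Longrightarrow> r x < i \<Longrightarrow> card {y \<in> V. r y < i \<and> A i x y} \<le> k"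
  shows "twin_width (V, E) \<le> k"
proof -
  have fin: "finite V" using bij bij_betw_finite by blast
  have cardV: "card V = N" using bij_betw_same_card[OF bij] by simp
  define c where "c = inv_into V r"
  have c: "c i \<in> V \<and> r (c i) = i" if "i < N" for i
    using that bij unfolding c_def bij_betw_def by (metis f_inv_into_f inv_into_into lessThan_iff)
  have c_eq: "x = c i" if "x \<in> V" "r x = i" for x i
    using that bij unfolding c_def bij_betw_def by (metis inv_into_f_f)
  \<comment> \<open>The merged vertex keeps the name of the parent, so every trigraph lives on
    original vertices. Contraction number \<open>Suc m\<close> removes the vertex of rank
    \<open>N - Suc m\<close>.\<close>
  define K where "K = rec_nat (trigraph_of (V, E))
    (\<lambda>m T. contract T (c (N - Suc m)) (p (c (N - Suc m))) (p (c (N - Suc m))))"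
  have K0: "K 0 = trigraph_of (V, E)"
    and KS: "K (Suc m) = contract (K m) (c (N - Suc m)) (p (c (N - Suc m))) (p (c (N - Suc m)))" for m
    by (simp_all add: K_def)
  define H where "H = (\<lambda>i. K (N - i))"
  have HN: "H N = trigraph_of (V, E)" by (simp add: H_def K0)
  have HS: "H i = contract (H (Suc i)) (c i) (p (c i)) (p (c i))" if "i < N" for i
  proof -
    have "N - i = Suc (N - Suc i)" "N - Suc (N - Suc i) = i" using that by auto
    then show ?thesis unfolding H_def by (metis KS)
  qed
  have inv: "verts (H i) = {x \<in> V. r x < i} \<and>
      (\<forall>x y. x \<in> V \<longrightarrow> y \<in> V \<longrightarrow> r x < i \<longrightarrow> r y < i \<longrightarrow> {x, y} \<in> black (H i) \<union> red (H i) \<longrightarrow> A i x y)"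
    if "1 \<le> i" "i \<le> N" for i
    using that(2,1)
  proof (induction i rule: inc_induct)
    case base
    show ?case
      using edges bij by (auto simp: HN trigraph_of_def bij_betw_def)
  next
    case (step i)
    define u where "u = c i"
    define v where "v = p u"
    have u: "u \<in> V" "r u = i" using c step.hyps by (auto simp: u_def)
    have v: "v \<in> V" "r v < i" using parent[OF u(1)] u(2) step.prems by (auto simp: v_def)
    have IH: "verts (H (Suc i)) = {x \<in> V. r x < Suc i}"
      and IA: "\<And>x y. x \<in> V \<Longrightarrow> y \<in> V \<Longrightarrow> r x < Suc i \<Longrightarrow> r y < Suc i \<Longrightarrow>
        {x, y} \<in> black (H (Suc i)) \<union> red (H (Suc i)) \<Longrightarrow> A (Suc i) x y"
      using step.IH by auto
    have Hi: "H i = contract (H (Suc i)) u v v" using HS step.hyps by (simp add: u_def v_def)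
    have "x \<noteq> u \<Longrightarrow> x \<in> V \<Longrightarrow> r x < Suc i \<Longrightarrow> r x < i" for x
      using c_eq u_def by (metis less_antisym)
    then have verts: "verts (H i) = {x \<in> V. r x < i}"
      unfolding Hi using v u by (auto simp: contract_def Let_def IH)
    \<comment> \<open>Adjacencies of the merged vertex inherited from \<open>u\<close> are covered
      by \<open>redirect\<close>, those inherited from \<open>v\<close> by
      \<open>keep\<close>.\<close>
    have new: "A i v z \<and> A i z v" if z: "z \<in> V" "r z < Suc i" "z \<noteq> u" "z \<noteq> v"
      and "{u, z} \<in> black (H (Suc i)) \<union> red (H (Suc i)) \<or> {v, z} \<in> black (H (Suc i)) \<union> red (H (Suc i))" for z
    proof -
      have rz: "r z < i" using z c_eq u_def by (metis less_antisym)
      from that(5) show ?thesis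
      proof
        assume "{u, z} \<in> black (H (Suc i)) \<union> red (H (Suc i))"
        then have "A (Suc i) u z" using IA u z by auto
        then show ?thesis using redirect[OF u(1) z(1)] rz u(2) z(4) by (simp add: v_def)
      next
        assume *: "{v, z} \<in> black (H (Suc i)) \<union> red (H (Suc i))"
        then have "A (Suc i) v z" using IA v z by auto
        moreover have "A (Suc i) z v" using IA[of z v] v z * by (auto simp: insert_commute)
        ultimately show ?thesis using keep v z rz by blast
      qed
    qed
    have "A i x y" if "x \<in> V" "y \<in> V" "r x < i" "r y < i" "{x, y} \<in> black (H i) \<union> red (H i)" for x y
    proof -
      from that(5) consider "{x, y} \<in> black (H (Suc i)) \<union> red (H (Suc i))"
        | z where "{x, y} = {v, z}" "z \<in> verts (H (Suc i)) - {u, v}"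
            "{u, z} \<in> black (H (Suc i)) \<union> red (H (Suc i)) \<or> {v, z} \<in> black (H (Suc i)) \<union> red (H (Suc i))"
        unfolding Hi by (auto simp: contract_def Let_def)
      then show ?thesis
      proof cases
        case 1
        then have "A (Suc i) x y" using IA that by auto
        then show ?thesis using keep that by blast
      next
        case 2
        then have "A i v z \<and> A i z v" using new[of z] IH by auto
        then show ?thesis using 2(1) by (auto simp: doubleton_eq_iff)
      qed
    qed
    then show ?case using verts by blast
  qed
  have card_lt: "card {x \<in> V. r x < i} = i" if "i \<le> N" for i
  proof -
    have "bij_betw r {x \<in> V. r x < i} {..<i}"
      unfolding bij_betw_def
    proof
      show "inj_on r {x \<in> V. r x < i}"
        using bij by (auto simp: bij_betw_def intro: inj_on_subset)
      have "j \<in> r ` {x \<in> V. r x < i}" if "j < i" for j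
        using c[of j] that \<open>i \<le> N\<close> by (intro image_eqI[of _ _ "c j"]) auto
      then show "r ` {x \<in> V. r x < i} = {..<i}" by auto
    qed
    from bij_betw_same_card[OF this] show ?thesis by simp
  qed
  have "contraction_sequence (V, E) H"
    unfolding contraction_sequence_def fst_conv cardV
  proof (intro conjI ballI)
    show "H N = trigraph_of (V, E)" by (rule HN)
    show "card (verts (H 1)) = 1" using inv[of 1] card_lt[of 1] N by simp
    fix i assume i: "i \<in> {1..<N}"
    then have u: "c i \<in> V" "r (c i) = i" using c by auto
    have v: "p (c i) \<in> V" "r (p (c i)) < i" using parent[OF u(1)] u(2) i by auto
    have "verts (H (Suc i)) = {x \<in> V. r x < Suc i}" using inv[of "Suc i"] i by auto
    then show "contracts_to (H (Suc i)) (H i)"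
      unfolding contracts_to_def using u v HS[of i] i
      by (intro exI[of _ "c i"] exI[of _ "p (c i)"]) auto
  qed
  moreover have "max_red_degree (H i) \<le> k" if "i \<in> {1..card (fst (V, E))}" for i
  proof -
    have i: "1 \<le> i" "i \<le> N" using that cardV by auto
    note I = inv[OF i]
    have "red_degree (H i) x \<le> k" if "x \<in> verts (H i)" for x
    proof -
      have x: "x \<in> V" "r x < i" using that I by auto
      have "red_degree (H i) x \<le> card {y \<in> V. r y < i \<and> A i x y}"
        unfolding red_degree_def using I x fin by (intro card_mono) auto
      then show ?thesis using degree[OF x] by linarith
    qed
    moreover have "finite (verts (H i))" "verts (H i) \<noteq> {}"
      using I fin card_lt[OF i(2)] i(1) by (auto simp del: Collect_empty_eq)
    ultimately show ?thesis unfolding max_red_degree_def by (subst Max_le_iff) auto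
  qed
  ultimately show ?thesis
    unfolding twin_width_def by (intro Least_le) blast
qed

subsection \<open>The colexicographic rank\<close>

text \<open>The number with base-\<open>n\<close> digits \<open>x i - 1\<close>, coordinate
  \<open>1\<close> being the least significant.\<close>

definition colex_rank :: "nat \<Rightarrow> nat \<Rightarrow> (nat \<Rightarrow> nat) \<Rightarrow> nat" where
  "colex_rank d n x = (\<Sum>i=1..d. (x i - 1) * n ^ (i - 1))"

lemma colex_rank_Suc: "colex_rank (Suc d) n x = colex_rank d n x + (x (Suc d) - 1) * n ^ d"
  by (simp add: colex_rank_def)

lemma colex_rank_less:
  assumes "\<forall>i\<in>{1..d}. x i \<in> {1..n}"
  shows "colex_rank d n x < n ^ d"
  using assms
proof (induction d)
  case 0
  then show ?case by (simp add: colex_rank_def)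
next
  case (Suc d)
  then have "colex_rank d n x < n ^ d" by auto
  moreover have "Suc (x (Suc d) - 1) \<le> n"
    using Suc.prems[rule_format, of "Suc d"] by auto
  then have "Suc (x (Suc d) - 1) * n ^ d \<le> n * n ^ d" by (rule mult_le_mono1)
  ultimately show ?case by (simp add: colex_rank_Suc)
qed

lemma colex_rank_eqD:
  assumes "\<forall>i\<in>{1..d}. x i \<in> {1..n}" "\<forall>i\<in>{1..d}. y i \<in> {1..n}"
    and "colex_rank d n x = colex_rank d n y"
  shows "\<forall>i\<in>{1..d}. x i = y i"
  using assms
proof (induction d)
  case 0
  then show ?case by simp
next
  case (Suc d)
  have less: "colex_rank d n x < n ^ d" "colex_rank d n y < n ^ d"
    using Suc.prems by (auto intro!: colex_rank_less)
  have eq: "colex_rank d n x + (x (Suc d) - 1) * n ^ d = colex_rank d n y + (y (Suc d) - 1) * n ^ d"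
    using Suc.prems(3) by (simp add: colex_rank_Suc)
  \<comment> \<open>Reduction modulo \<open>n ^ d\<close> removes the top digit.\<close>
  from arg_cong[OF eq, of "\<lambda>a. a mod n ^ d"] less have eq_d: "colex_rank d n x = colex_rank d n y"
    by simp
  have IH: "\<forall>i\<in>{1..d}. x i = y i"
    by (rule Suc.IH[OF _ _ eq_d]) (use Suc.prems(1,2) in auto)
  have "n ^ d \<noteq> 0" using less by linarith
  with eq eq_d have "x (Suc d) - 1 = y (Suc d) - 1" by (simp only: add_left_cancel mult_cancel2) simp
  moreover have "x (Suc d) \<ge> 1" "y (Suc d) \<ge> 1"
    using Suc.prems(1,2)[rule_format, of "Suc d"] by auto
  ultimately have "x (Suc d) = y (Suc d)" by linarith
  with IH show ?case by (auto simp: le_Suc_eq)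
qed

text \<open>An injection into a set of the same finite size \<open>n ^ d\<close> is onto.\<close>

lemma bij_betw_colex_rank: "bij_betw (colex_rank d n) ({1..d} \<rightarrow>\<^sub>E {1..n}) {..<n ^ d}"
proof -
  let ?V = "{1..d} \<rightarrow>\<^sub>E {1..n}"
  have inj: "inj_on (colex_rank d n) ?V"
  proof (rule inj_onI)
    fix x y assume xy: "x \<in> ?V" "y \<in> ?V" and eq: "colex_rank d n x = colex_rank d n y"
    have "\<forall>i\<in>{1..d}. x i = y i" by (rule colex_rank_eqD[OF _ _ eq]) (use xy in auto)
    with xy show "x = y" by (auto intro: PiE_ext)
  qed
  have "x \<in> ?V \<Longrightarrow> colex_rank d n x < n ^ d" for x
    by (rule colex_rank_less) auto
  then have "colex_rank d n ` ?V = {..<n ^ d}"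
    using card_image[OF inj] by (intro card_subset_eq) (auto simp: card_PiE)
  with inj show ?thesis by (simp add: bij_betw_def)
qed

section \<open>Unit steps in the grid\<close>

definition inc :: "nat \<Rightarrow> (nat \<Rightarrow> nat) \<Rightarrow> nat \<Rightarrow> nat" where
  "inc j x = x(j := Suc (x j))"

text \<open>Subtraction truncates at \<open>0\<close>, so \<open>inc\<close> undoes
  \<open>dec\<close> only at a positive coordinate, while \<open>dec\<close> always undoes
  \<open>inc\<close>. Adjacency is therefore stated additively, with \<open>inc\<close> on both
  sides.\<close>

definition dec :: "nat \<Rightarrow> (nat \<Rightarrow> nat) \<Rightarrow> nat \<Rightarrow> nat" where
  "dec j x = x(j := x j - 1)"

lemma inc_apply: "inc j x l = (if l = j then Suc (x l) else x l)"
  by (simp add: inc_def)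

lemma dec_inc [simp]: "dec j (inc j x) = x"
  by (simp add: inc_def dec_def)

lemma inc_inject: "inc j x = inc j y \<longleftrightarrow> x = y"
  by (metis dec_inc)

lemma inc_commute: "inc j (inc k x) = inc k (inc j x)"
  by (auto simp: inc_def)

text \<open>At \<open>x j = 0\<close> the truncated digit \<open>x j - 1\<close> would stay
  \<open>0\<close>; at a positive coordinate it grows by one.\<close>

lemma colex_rank_inc:
  assumes "j \<in> {1..d}" and "x j \<ge> 1"
  shows "colex_rank d n (inc j x) = colex_rank d n x + n ^ (j - 1)"
proof -
  have "colex_rank d n (inc j x) = x j * n ^ (j - 1) + (\<Sum>i\<in>{1..d}-{j}. (x i - 1) * n ^ (i - 1))"
    unfolding colex_rank_def using assms(1) by (subst sum.remove[of _ j]) (auto simp: inc_def)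
  moreover have "colex_rank d n x = (x j - 1) * n ^ (j - 1) + (\<Sum>i\<in>{1..d}-{j}. (x i - 1) * n ^ (i - 1))"
    unfolding colex_rank_def using assms(1) by (subst sum.remove[of _ j]) auto
  moreover have "x j * n ^ (j - 1) = (x j - 1) * n ^ (j - 1) + n ^ (j - 1)"
    using assms(2) by (cases "x j") auto
  ultimately show ?thesis by simp
qed

text \<open>A positive rank forces some coordinate to differ from \<open>1\<close>; lowering the
  last such coordinate gives the parent.\<close>

lemma ex_colex_parent:
  assumes u: "u \<in> {1..d} \<rightarrow>\<^sub>E {1..n}" and pos: "colex_rank d n u > 0"
  shows "\<exists>v. \<exists>k\<in>{1..d}. v \<in> {1..d} \<rightarrow>\<^sub>E {1..n} \<and> inc k v = u \<and> (\<forall>l\<in>{k<..d}. u l = 1)"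
proof -
  define S where "S = {l \<in> {1..d}. u l \<noteq> 1}"
  have "S \<noteq> {}"
  proof
    assume "S = {}"
    then have "colex_rank d n u = 0" by (auto simp: colex_rank_def S_def)
    with pos show False by simp
  qed
  moreover have fin: "finite S" by (simp add: S_def)
  ultimately have "Max S \<in> S" by (rule Max_in[rotated])
  then have k: "Max S \<in> {1..d}" "u (Max S) \<noteq> 1" by (auto simp: S_def)
  have "u (Max S) \<in> {1..n}" using u k(1) by blast
  with k(2) have uk: "2 \<le> u (Max S)" "u (Max S) \<le> n" by auto
  have top: "u l = 1" if "l \<in> {Max S<..d}" for l
  proof (rule ccontr)
    assume "u l \<noteq> 1"
    then have "l \<in> S" using that k(1) by (auto simp: S_def)
    then show False using Max_ge[OF fin] that by (auto simp: not_le[symmetric])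
  qed
  have "dec (Max S) u \<in> {1..d} \<rightarrow>\<^sub>E {1..n}"
    using u k(1) uk unfolding dec_def by (intro PiE_I) (auto simp: PiE_iff extensional_def intro: le_trans[OF diff_le_self])
  moreover have "inc (Max S) (dec (Max S) u) = u"
    using uk by (auto simp: inc_def dec_def)
  ultimately show ?thesis using k top by blast
qed

text \<open>Nonnegative integers with sum \<open>1\<close> have a single nonzero term, equal to
  \<open>1\<close>. Outside \<open>{1..d}\<close> both points are \<open>undefined\<close>, so they
  agree as functions away from \<open>j\<close>.\<close>

lemma grid_adj_imp_inc:
  assumes x: "x \<in> {1..d} \<rightarrow>\<^sub>E {1..n}" and y: "y \<in> {1..d} \<rightarrow>\<^sub>E {1..n}" and adj: "grid_adj d x y"
  shows "\<exists>j\<in>{1..d}. y = inc j x \<or> x = inc j y"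
proof -
  let ?f = "\<lambda>i. \<bar>int (x i) - int (y i)\<bar>"
  have s: "sum ?f {1..d} = 1" using adj by (simp add: grid_adj_def)
  then obtain j where j: "j \<in> {1..d}" "?f j \<noteq> 0"
    by (metis (mono_tags, lifting) sum.neutral zero_neq_one)
  have "?f j + sum ?f ({1..d} - {j}) = 1" using s j(1) by (simp add: sum.remove[of _ j])
  moreover have "sum ?f ({1..d} - {j}) \<ge> 0" by (simp add: sum_nonneg)
  ultimately have fj: "?f j = 1" and "sum ?f ({1..d} - {j}) = 0" using j(2) by linarith+
  then have "\<forall>i\<in>{1..d} - {j}. x i = y i" by (subst (asm) sum_nonneg_eq_0_iff) auto
  then have eq: "x i = y i" if "i \<noteq> j" for i
    using that x y by (cases "i \<in> {1..d}") (auto simp: PiE_iff extensional_def)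
  from fj have "y j = Suc (x j) \<or> x j = Suc (y j)" by linarith
  then have "y = inc j x \<or> x = inc j y" using eq by (auto simp: inc_def fun_eq_iff)
  with j(1) show ?thesis by blast
qed

subsection \<open>Adjacency during the elimination\<close>

text \<open>The vertex \<open>u = x + e\<^sub>k\<close> has been merged into its parent \<open>x\<close>, and its lower neighbour
  \<open>y = u - e\<^sub>j\<close> has not been eliminated yet.\<close>

definition diag_adj :: "nat \<Rightarrow> nat \<Rightarrow> nat \<Rightarrow> nat \<Rightarrow> nat \<Rightarrow> (nat \<Rightarrow> nat) \<Rightarrow> (nat \<Rightarrow> nat) \<Rightarrow> bool" where
  "diag_adj d n i j k x y \<longleftrightarrow> 1 \<le> j \<and> j < k \<and> k \<le> d \<and> inc j y = inc k x \<and>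
     (\<forall>l\<in>{k<..d}. x l = 1) \<and> colex_rank d n y < i \<and> i \<le> colex_rank d n (inc k x)"

definition elim_adj :: "nat \<Rightarrow> nat \<Rightarrow> nat \<Rightarrow> (nat \<Rightarrow> nat) \<Rightarrow> (nat \<Rightarrow> nat) \<Rightarrow> bool" where
  "elim_adj d n i x y \<longleftrightarrow> (\<exists>j\<in>{1..d}. y = inc j x \<or> x = inc j y) \<or>
     (\<exists>j k. diag_adj d n i j k x y \<or> diag_adj d n i j k y x)"

lemma elim_adj_commute: "elim_adj d n i x y \<longleftrightarrow> elim_adj d n i y x"
  by (auto simp: elim_adj_def)

text \<open>Only the diagonal part depends on \<open>i\<close>. Its upper bound on \<open>i\<close>
  survives when \<open>i\<close> drops, and its lower bound says that the lower neighbour still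
  remains.\<close>

lemma elim_adj_keep:
  assumes "elim_adj d n (Suc i) x y" and "colex_rank d n x < i" "colex_rank d n y < i"
  shows "elim_adj d n i x y"
proof -
  have "diag_adj d n (Suc i) j k a b \<Longrightarrow> colex_rank d n b < i \<Longrightarrow> diag_adj d n i j k a b" for j k a b
    by (auto simp: diag_adj_def)
  with assms show ?thesis unfolding elim_adj_def by blast
qed

text \<open>The cases \<open>up\<close> and \<open>diag1\<close> contradict the smaller rank of
  \<open>x\<close>. In \<open>down\<close>, \<open>x\<close> becomes a diagonal neighbour of
  \<open>v\<close>; in \<open>diag2\<close>, it is an ordinary grid neighbour of
  \<open>v\<close>.\<close>

lemma elim_adj_redirect:
  assumes V: "u \<in> {1..d} \<rightarrow>\<^sub>E {1..n}" "v \<in> {1..d} \<rightarrow>\<^sub>E {1..n}" "x \<in> {1..d} \<rightarrow>\<^sub>E {1..n}"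
    and k: "k \<in> {1..d}" and uv: "inc k v = u" and top: "\<forall>l\<in>{k<..d}. u l = 1"
    and less: "colex_rank d n x < colex_rank d n u" and "x \<noteq> v"
    and adj: "elim_adj d n (Suc (colex_rank d n u)) u x"
  shows "elim_adj d n (colex_rank d n u) v x"
proof -
  let ?r = "colex_rank d n"
  have ge1: "u l \<ge> 1 \<and> v l \<ge> 1 \<and> x l \<ge> 1 \<and> n \<ge> 1" if "l \<in> {1..d}" for l
    using that V by (fastforce simp: PiE_iff)
  from adj consider (up) j where "j \<in> {1..d}" "x = inc j u" | (down) j where "j \<in> {1..d}" "u = inc j x"
    | (diag1) j k' where "diag_adj d n (Suc (?r u)) j k' u x"
    | (diag2) j k' where "diag_adj d n (Suc (?r u)) j k' x u"
    unfolding elim_adj_def by blast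
  then show ?thesis
  proof cases
    case up
    then have "?r x \<ge> ?r u" using colex_rank_inc[of j d u n] ge1[of j] by simp
    with less show ?thesis by simp
  next
    case down
    have "j \<noteq> k" using down uv \<open>x \<noteq> v\<close> inc_inject by metis
    moreover have "\<not> k < j"
    proof
      assume "k < j"
      then have "u j = 1" using top down by auto
      then show False using down ge1[of j] by (auto simp: inc_apply)
    qed
    ultimately have "j < k" by simp
    moreover have "\<forall>l\<in>{k<..d}. v l = 1" using top uv by (auto simp: inc_apply split: if_splits)
    ultimately have "diag_adj d n (?r u) j k v x"
      using down k uv less by (auto simp: diag_adj_def)
    then show ?thesis unfolding elim_adj_def by blast
  next
    case diag1
    then have jk: "1 \<le> j" "j < k'" "k' \<le> d" "inc j x = inc k' u" by (auto simp: diag_adj_def)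
    \<comment> \<open>Here \<open>x\<close> is \<open>u + e_k' - e_j\<close> with
      \<open>j < k'\<close>, so its rank is at least that of \<open>u\<close>.\<close>
    have "?r (inc j x) = ?r x + n ^ (j - 1)" "?r (inc k' u) = ?r u + n ^ (k' - 1)"
      using colex_rank_inc ge1 jk(1-3) by simp_all
    moreover have "n ^ (j - 1) \<le> n ^ (k' - 1)" using jk ge1[of j] by (intro power_increasing) auto
    ultimately show ?thesis using jk(4) less by simp
  next
    case diag2
    then have jk: "1 \<le> j" "j < k'" "k' \<le> d" "inc j u = inc k' x" "\<forall>l\<in>{k'<..d}. x l = 1"
      by (auto simp: diag_adj_def)
    have at: "inc j u l = inc k' x l" for l using jk(4) by simp
    \<comment> \<open>If \<open>k < k'\<close>, then \<open>u k'\<close> is both \<open>1\<close>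
      and \<open>x k' + 1\<close>; if \<open>k' < k\<close>, then \<open>u k\<close> is both
      \<open>1\<close> and \<open>v k + 1\<close>. Hence the diagonal has the direction of the
      parent step, which cancels.\<close>
    have "\<not> k < k'"
    proof
      assume "k < k'"
      then have "u k' = 1" using top jk by auto
      then show False using at[of k'] jk(1-3) ge1[of k'] by (auto simp: inc_apply)
    qed
    moreover have "\<not> k' < k"
    proof
      assume "k' < k"
      then have "x k = 1" using jk k by auto
      then have "u k = 1" using at[of k] jk(2) \<open>k' < k\<close> by (auto simp: inc_apply)
      then show False using uv ge1[OF k] by (auto simp: inc_apply)
    qed
    ultimately have "k' = k" by simp
    with jk(4) uv have "inc k (inc j v) = inc k x" by (metis inc_commute)
    then have "x = inc j v" by (simp add: inc_inject)
    then show ?thesis unfolding elim_adj_def using jk by auto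
  qed
qed

section \<open>Counting the neighbours of a remaining vertex\<close>

text \<open>The remaining vertex \<open>y = x + e\<^sub>k - e\<^sub>j\<close> has rank at least that of \<open>x + e\<^sub>m\<close>, because
  \<open>n\<^sup>k \<ge> n\<^sup>j + n\<^sup>m\<close> for \<open>j, m < k\<close> and \<open>n \<ge> 2\<close>.\<close>

lemma diag_adj_no_lower:
  assumes V: "x \<in> {1..d} \<rightarrow>\<^sub>E {1..n}" "y \<in> {1..d} \<rightarrow>\<^sub>E {1..n}"
    and D: "diag_adj d n i j k x y" and m: "1 \<le> m" "m < k"
  shows "colex_rank d n (inc m x) < i"
proof -
  let ?r = "colex_rank d n"
  have ge1: "x l \<ge> 1 \<and> y l \<in> {1..n}" if "l \<in> {1..d}" for l
    using that V by (fastforce simp: PiE_iff)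
  have jk: "1 \<le> j" "j < k" "k \<le> d" "inc j y = inc k x" "?r y < i"
    using D by (auto simp: diag_adj_def)
  have "inc j y k = inc k x k" using jk(4) by simp
  then have "y k = Suc (x k)" using jk(2) by (simp add: inc_apply)
  then have n: "n \<ge> 2" using ge1[of k] jk by auto
  have r: "?r (inc j y) = ?r y + n ^ (j - 1)" "?r (inc k x) = ?r x + n ^ (k - 1)"
    "?r (inc m x) = ?r x + n ^ (m - 1)"
    using colex_rank_inc ge1 jk(1-3) m by simp_all
  \<comment> \<open>The exponents \<open>j - 1\<close> and \<open>m - 1\<close> are at most
    \<open>k - 2\<close>, and two copies of \<open>n ^ (k - 2)\<close> fit into
    \<open>n ^ (k - 1)\<close>.\<close>
  have "n ^ (j - 1) \<le> n ^ (k - 2)" "n ^ (m - 1) \<le> n ^ (k - 2)"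
    using jk m n by (auto intro!: power_increasing)
  then have "n ^ (j - 1) + n ^ (m - 1) \<le> 2 * n ^ (k - 2)" by simp
  also have "\<dots> \<le> n * n ^ (k - 2)" using n by (rule mult_le_mono1)
  also have "\<dots> = n ^ (k - 1)" using jk by (simp flip: power_Suc add: Suc_diff_Suc numeral_2_eq_2)
  finally show ?thesis using r jk(4,5) by simp
qed

text \<open>As \<open>j < k\<close>, coordinate \<open>k\<close> of \<open>y\<close> is that of
  \<open>x + e_k\<close>. This clashes with diagonal adjacencies that force the coordinate to be
  \<open>1\<close>, which separates different directions.\<close>

lemma diag_adj_coordinate:
  assumes V: "x \<in> {1..d} \<rightarrow>\<^sub>E {1..n}" and D: "diag_adj d n i j k x y"
  shows "y k \<ge> 2"
proof -
  have jk: "1 \<le> j" "j < k" "k \<le> d" "inc j y = inc k x" using D by (auto simp: diag_adj_def)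
  have "inc j y k = inc k x k" using jk(4) by simp
  moreover have "x k \<ge> 1" using V jk by (fastforce simp: PiE_iff)
  ultimately show ?thesis using jk(2) by (simp add: inc_apply)
qed

text \<open>An image of \<open>{1..d}\<close> has at most \<open>d\<close> elements. If some
  neighbour is \<open>x + e_k - e_j\<close>, comparing ranks fixes \<open>k\<close> and excludes the
  other kind; otherwise the coordinates forced to be \<open>1\<close> fix \<open>k\<close> for the
  neighbours \<open>x - e_k + e_j\<close>.\<close>

lemma diag_neighbours_image:
  assumes x: "x \<in> {1..d} \<rightarrow>\<^sub>E {1..n}"
  shows "\<exists>g. {y \<in> {1..d} \<rightarrow>\<^sub>E {1..n}. \<exists>j k. diag_adj d n i j k x y \<or> diag_adj d n i j k y x} \<subseteq> g ` {1..d}"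
proof (cases "\<exists>y \<in> {1..d} \<rightarrow>\<^sub>E {1..n}. \<exists>j k. diag_adj d n i j k x y")
  case True
  then obtain y0 j0 k where y0: "y0 \<in> {1..d} \<rightarrow>\<^sub>E {1..n}" and D0: "diag_adj d n i j0 k x y0"
    by blast
  have "y \<in> (\<lambda>j. dec j (inc k x)) ` {1..d}"
    if y: "y \<in> {1..d} \<rightarrow>\<^sub>E {1..n}" and "\<exists>j k. diag_adj d n i j k x y \<or> diag_adj d n i j k y x" for y
  proof -
    from that(2) consider (pos) j k' where "diag_adj d n i j k' x y"
      | (neg) j k' where "diag_adj d n i j k' y x" by blast
    then show ?thesis
    proof cases
      case pos
      \<comment> \<open>The larger of two directions would make \<open>x\<close> plus the smaller
        one have rank below \<open>i\<close>, although that vertex is already eliminated.\<close>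
      have "\<not> k < k'"
        using diag_adj_no_lower[OF x y pos, of k] D0 by (auto simp: diag_adj_def)
      moreover have "\<not> k' < k"
        using diag_adj_no_lower[OF x y0 D0, of k'] pos by (auto simp: diag_adj_def)
      ultimately have "k' = k" by simp
      then have "y = dec j (inc k x)" "j \<in> {1..d}"
        using pos by (auto simp: diag_adj_def dest: arg_cong[of _ _ "dec j"])
      then show ?thesis by blast
    next
      case neg
      have "k' \<le> k"
      proof (rule ccontr)
        assume "\<not> k' \<le> k"
        then have "x k' = 1" using D0 neg by (auto simp: diag_adj_def)
        then show False using diag_adj_coordinate[OF y neg] by simp
      qed
      \<comment> \<open>But \<open>inc j x = inc k' y\<close> is the eliminated vertex behind
        \<open>neg\<close>, of rank at least \<open>i\<close>: the two kinds cannot coexist.\<close>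
      then have "colex_rank d n (inc j x) < i"
        using diag_adj_no_lower[OF x y0 D0, of j] neg by (auto simp: diag_adj_def)
      then show ?thesis using neg by (auto simp: diag_adj_def)
    qed
  qed
  then show ?thesis by blast
next
  case False
  show ?thesis
  proof (cases "\<exists>y \<in> {1..d} \<rightarrow>\<^sub>E {1..n}. \<exists>j k. diag_adj d n i j k y x")
    case True
    then obtain y0 j0 k where y0: "y0 \<in> {1..d} \<rightarrow>\<^sub>E {1..n}" and D0: "diag_adj d n i j0 k y0 x"
      by blast
    have le: "k2 \<le> k1" if y: "y2 \<in> {1..d} \<rightarrow>\<^sub>E {1..n}"
      and D1: "diag_adj d n i j1 k1 y1 x" and D2: "diag_adj d n i j2 k2 y2 x" for j1 k1 y1 j2 k2 y2
    proof (rule ccontr)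
      assume "\<not> k2 \<le> k1"
      then have less: "j1 < k1" "k1 < k2" using D1 by (auto simp: diag_adj_def)
      \<comment> \<open>Beyond \<open>k1\<close> all coordinates of \<open>y1\<close> are
        \<open>1\<close>, and \<open>x\<close> agrees with \<open>y1\<close> there because
        \<open>j1 < k1\<close>.\<close>
      have "y1 k2 = 1" "inc j1 x k2 = inc k1 y1 k2" using D1 D2 less by (auto simp: diag_adj_def)
      then have "x k2 = 1" using less by (simp add: inc_apply)
      then show False using diag_adj_coordinate[OF y D2] by simp
    qed
    have "y \<in> (\<lambda>j. dec k (inc j x)) ` {1..d}"
      if y: "y \<in> {1..d} \<rightarrow>\<^sub>E {1..n}" and D: "diag_adj d n i j k' y x" for y j k'
    proof -
      have "k' = k" using le[OF y D0 D] le[OF y0 D D0] by simp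
      then have "y = dec k (inc j x)" "j \<in> {1..d}" using D by (auto simp: diag_adj_def)
      then show ?thesis by blast
    qed
    with False show ?thesis by blast
  next
    case none: False
    with False show ?thesis by blast
  qed
qed

lemma elim_adj_degree:
  assumes x: "x \<in> {1..d} \<rightarrow>\<^sub>E {1..n}"
  shows "card {y \<in> {1..d} \<rightarrow>\<^sub>E {1..n}. P y \<and> elim_adj d n i x y} \<le> 3 * d"
proof -
  obtain g where g: "{y \<in> {1..d} \<rightarrow>\<^sub>E {1..n}. \<exists>j k. diag_adj d n i j k x y \<or> diag_adj d n i j k y x} \<subseteq> g ` {1..d}"
    using diag_neighbours_image[OF x] by blast
  \<comment> \<open>Upper, lower and diagonal neighbours: three families of at most \<open>d\<close>
    each.\<close>
  let ?I = "(\<lambda>j. inc j x) ` {1..d}" and ?D = "(\<lambda>j. dec j x) ` {1..d}" and ?G = "g ` {1..d}"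
  have "{y \<in> {1..d} \<rightarrow>\<^sub>E {1..n}. P y \<and> elim_adj d n i x y} \<subseteq> ?I \<union> ?D \<union> ?G"
  proof
    fix y assume "y \<in> {y \<in> {1..d} \<rightarrow>\<^sub>E {1..n}. P y \<and> elim_adj d n i x y}"
    then have y: "y \<in> {1..d} \<rightarrow>\<^sub>E {1..n}" "elim_adj d n i x y" by auto
    then consider "y \<in> ?I" | j where "j \<in> {1..d}" "x = inc j y" | "y \<in> ?G"
      unfolding elim_adj_def using g by blast
    then show "y \<in> ?I \<union> ?D \<union> ?G"
    proof cases
      case 2
      then have "y = dec j x" by simp
      with 2(1) show ?thesis by blast
    qed auto
  qed
  then have "card {y \<in> {1..d} \<rightarrow>\<^sub>E {1..n}. P y \<and> elim_adj d n i x y} \<le> card (?I \<union> ?D \<union> ?G)"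
    by (intro card_mono) auto
  also have "\<dots> \<le> card ?I + card ?D + card ?G"
    using card_Un_le[of "?I \<union> ?D" ?G] card_Un_le[of ?I ?D] by linarith
  also have "\<dots> \<le> 3 * d"
    using card_image_le[of "{1..d}" "\<lambda>j. inc j x"] card_image_le[of "{1..d}" "\<lambda>j. dec j x"]
      card_image_le[of "{1..d}" g] by simp
  finally show ?thesis .
qed

section \<open>The elimination order applied to the grid\<close>

theorem theorem4p3:
  fixes d n :: nat
  assumes "d \<ge> 1" and "n \<ge> 1"
  shows "twin_width (grid d n) \<le> 3 * d"
proof -
  let ?V = "{1..d} \<rightarrow>\<^sub>E {1..n}" and ?r = "colex_rank d n"
  define E where "E = {{x, y} |x y. x \<in> ?V \<and> y \<in> ?V \<and> grid_adj d x y}"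
  \<comment> \<open>The conditions on \<open>u\<close> stand under the existential so that choice
    yields a total function \<open>p\<close>, unconstrained off the vertices of positive
    rank.\<close>
  have "\<forall>u. \<exists>v. u \<in> ?V \<and> ?r u > 0 \<longrightarrow>
      v \<in> ?V \<and> (\<exists>k\<in>{1..d}. inc k v = u \<and> (\<forall>l\<in>{k<..d}. u l = 1))"
    using ex_colex_parent by blast
  then obtain p where p: "\<And>u. u \<in> ?V \<Longrightarrow> ?r u > 0 \<Longrightarrow>
      p u \<in> ?V \<and> (\<exists>k\<in>{1..d}. inc k (p u) = u \<and> (\<forall>l\<in>{k<..d}. u l = 1))"
    by metis
  have "twin_width (?V, E) \<le> 3 * d"
  proof (rule twin_width_le_elimination[where r = ?r and p = p and A = "elim_adj d n" and N = "n ^ d"])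
    show "bij_betw ?r ?V {..<n ^ d}" by (rule bij_betw_colex_rank)
    show "n ^ d \<ge> 1" using assms by simp
    show "elim_adj d n (n ^ d) x y" if edge: "{x, y} \<in> E" for x y
    proof -
      obtain a b where "{x, y} = {a, b}" "a \<in> ?V" "b \<in> ?V" "grid_adj d a b"
        using edge by (auto simp: E_def)
      moreover from this have "elim_adj d n (n ^ d) a b"
        unfolding elim_adj_def using grid_adj_imp_inc by blast
      ultimately show ?thesis by (metis doubleton_eq_iff elim_adj_commute)
    qed
    show "p u \<in> ?V \<and> ?r (p u) < ?r u" if u: "u \<in> ?V" "?r u > 0" for u
    proof -
      obtain k where k: "k \<in> {1..d}" "inc k (p u) = u" and V: "p u \<in> ?V" using p[OF u] by blast
      have "p u k \<ge> 1" using V k(1) by (fastforce simp: PiE_iff)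
      then show ?thesis using colex_rank_inc[OF k(1), of "p u" n] k V assms by simp
    qed
    show "elim_adj d n i x y"
      if "?r x < i" "?r y < i" "elim_adj d n (Suc i) x y" for i x y
      using elim_adj_keep that by blast
    show "elim_adj d n (?r u) (p u) x \<and> elim_adj d n (?r u) x (p u)"
      if "u \<in> ?V" "x \<in> ?V" "?r x < ?r u" "x \<noteq> p u" "elim_adj d n (Suc (?r u)) u x" for u x
      using elim_adj_redirect[of u d n "p u" x] p[of u] that elim_adj_commute by auto
    show "card {y \<in> ?V. ?r y < i \<and> elim_adj d n i x y} \<le> 3 * d" if "x \<in> ?V" for i x
      using elim_adj_degree[OF that] .
  qed
  then show ?thesis by (simp add: grid_def Let_def E_def)
qed

end
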